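(* Let $G$ be a perfectly labeled graph on $[n]$. If $G$ is crossing closed, then $NC_G$ is a supersolvable lattice.
   Context: Graphs are finite simple graphs with vertex set $[n]$; edges are written $ij$ with $i<j$. Two edges $a_1a_2$ and $b_1b_2$ cross if $a_1<b_1<a_2<b_2$ or $b_1<a_1<b_2<a_2$. $G$ is perfectly labeled if whenever $ik,jk\in E(G)$ with $i<j<k$, also $ij\in E(G)$. A bond of $G$ is a spanning subgraph (identified with its edge set) each of whose connected components is an induced subgraph of $G$; it is noncrossing if there are no two distinct components with vertex sets $B,B'$ and $a,c\in B$, $b,d\in B'$, $a<b<c<d$. $NC_G$ is the poset of noncrossing bonds ordered by inclusion of edge sets. Two crossing edges $e,f$ are crossing closed if among all induced connected subgraphs of $G$ containing $e$ and $f$ there is a unique minimal one under containment; $G$ is crossing closed if every pair of crossing edges is. A finite lattice is supersolvable if it has a maximal chain $\mathbf{m}$ such that for every chain $\mathbf{c}$, the sublattice generated by $\mathbf{m}$ and $\mathbf{c}$ is distributive. *)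

theory Defs
  imports Main
begin

section \<open>Finite posets, lattices, supersolvability (carrier set + order relation)\<close>

definition is_lub :: "'a set \<Rightarrow> ('a \<Rightarrow> 'a \<Rightarrow> bool) \<Rightarrow> 'a \<Rightarrow> 'a \<Rightarrow> 'a \<Rightarrow> bool" where
  "is_lub P le x y z \<longleftrightarrow> z \<in> P \<and> le x z \<and> le y z \<and>
     (\<forall>w\<in>P. le x w \<and> le y w \<longrightarrow> le z w)"

definition is_glb :: "'a set \<Rightarrow> ('a \<Rightarrow> 'a \<Rightarrow> bool) \<Rightarrow> 'a \<Rightarrow> 'a \<Rightarrow> 'a \<Rightarrow> bool" where
  "is_glb P le x y z \<longleftrightarrow> z \<in> P \<and> le z x \<and> le z y \<and>
     (\<forall>w\<in>P. le w x \<and> le w y \<longrightarrow> le w z)"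

definition poset_on :: "'a set \<Rightarrow> ('a \<Rightarrow> 'a \<Rightarrow> bool) \<Rightarrow> bool" where
  "poset_on P le \<longleftrightarrow>
     (\<forall>x\<in>P. le x x) \<and>
     (\<forall>x\<in>P. \<forall>y\<in>P. le x y \<and> le y x \<longrightarrow> x = y) \<and>
     (\<forall>x\<in>P. \<forall>y\<in>P. \<forall>z\<in>P. le x y \<and> le y z \<longrightarrow> le x z)"

text \<open>A finite lattice: a finite nonempty poset in which every two elements have a
  least upper bound and a greatest lower bound.\<close>
definition finite_lattice :: "'a set \<Rightarrow> ('a \<Rightarrow> 'a \<Rightarrow> bool) \<Rightarrow> bool" where
  "finite_lattice P le \<longleftrightarrow> finite P \<and> P \<noteq> {} \<and> poset_on P le \<and>
     (\<forall>x\<in>P. \<forall>y\<in>P. (\<exists>z. is_lub P le x y z) \<and> (\<exists>z. is_glb P le x y z))"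

definition ljoin :: "'a set \<Rightarrow> ('a \<Rightarrow> 'a \<Rightarrow> bool) \<Rightarrow> 'a \<Rightarrow> 'a \<Rightarrow> 'a" where
  "ljoin P le x y = (THE z. is_lub P le x y z)"

definition lmeet :: "'a set \<Rightarrow> ('a \<Rightarrow> 'a \<Rightarrow> bool) \<Rightarrow> 'a \<Rightarrow> 'a \<Rightarrow> 'a" where
  "lmeet P le x y = (THE z. is_glb P le x y z)"

definition is_chain :: "'a set \<Rightarrow> ('a \<Rightarrow> 'a \<Rightarrow> bool) \<Rightarrow> 'a set \<Rightarrow> bool" where
  "is_chain P le C \<longleftrightarrow> C \<subseteq> P \<and> (\<forall>x\<in>C. \<forall>y\<in>C. le x y \<or> le y x)"

definition maximal_chain :: "'a set \<Rightarrow> ('a \<Rightarrow> 'a \<Rightarrow> bool) \<Rightarrow> 'a set \<Rightarrow> bool" where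
  "maximal_chain P le C \<longleftrightarrow> is_chain P le C \<and>
     (\<forall>D. is_chain P le D \<and> C \<subseteq> D \<longrightarrow> D = C)"

text \<open>Sublattice of the lattice P generated by X: the smallest subset of P containing X
  and closed under the join and meet of P.\<close>
definition gen_sublattice :: "'a set \<Rightarrow> ('a \<Rightarrow> 'a \<Rightarrow> bool) \<Rightarrow> 'a set \<Rightarrow> 'a set" where
  "gen_sublattice P le X = \<Inter>{S. X \<subseteq> S \<and> S \<subseteq> P \<and>
     (\<forall>x\<in>S. \<forall>y\<in>S. ljoin P le x y \<in> S \<and> lmeet P le x y \<in> S)}"

definition distributive_sub :: "'a set \<Rightarrow> ('a \<Rightarrow> 'a \<Rightarrow> bool) \<Rightarrow> 'a set \<Rightarrow> bool" where
  "distributive_sub P le S \<longleftrightarrow> (\<forall>x\<in>S. \<forall>y\<in>S. \<forall>z\<in>S.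
     lmeet P le x (ljoin P le y z) = ljoin P le (lmeet P le x y) (lmeet P le x z))"

definition supersolvable_lattice :: "'a set \<Rightarrow> ('a \<Rightarrow> 'a \<Rightarrow> bool) \<Rightarrow> bool" where
  "supersolvable_lattice P le \<longleftrightarrow> finite_lattice P le \<and>
     (\<exists>M. maximal_chain P le M \<and>
        (\<forall>C. is_chain P le C \<longrightarrow> distributive_sub P le (gen_sublattice P le (M \<union> C))))"

section \<open>Graphs on [n]: edge sets of pairs (i,j) with 1 \<le> i < j \<le> n\<close>

type_synonym edges = "(nat \<times> nat) set"

definition graph_on :: "nat \<Rightarrow> edges \<Rightarrow> bool" where
  "graph_on n E \<longleftrightarrow> (\<forall>(i,j)\<in>E. 1 \<le> i \<and> i < j \<and> j \<le> n)"

definition perfectly_labeled :: "edges \<Rightarrow> bool" where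
  "perfectly_labeled E \<longleftrightarrow>
     (\<forall>i j k. i < j \<and> j < k \<and> (i,k) \<in> E \<and> (j,k) \<in> E \<longrightarrow> (i,j) \<in> E)"

definition crossing :: "nat \<times> nat \<Rightarrow> nat \<times> nat \<Rightarrow> bool" where
  "crossing e f \<longleftrightarrow> (case e of (a1,a2) \<Rightarrow> case f of (b1,b2) \<Rightarrow>
     (a1 < b1 \<and> b1 < a2 \<and> a2 < b2) \<or> (b1 < a1 \<and> a1 < b2 \<and> b2 < a2))"

text \<open>Edges of the induced subgraph of E on vertex set W.\<close>
definition induced :: "edges \<Rightarrow> nat set \<Rightarrow> edges" where
  "induced E W = {(i,j)\<in>E. i \<in> W \<and> j \<in> W}"

text \<open>The subgraph with vertex set W and edge set S is connected.\<close>
definition connected_on :: "edges \<Rightarrow> nat set \<Rightarrow> bool" where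
  "connected_on S W \<longleftrightarrow> W \<noteq> {} \<and>
     (\<forall>u\<in>W. \<forall>v\<in>W. (u,v) \<in> (induced S W \<union> (induced S W)\<inverse>)\<^sup>*)"

text \<open>Vertex sets of induced connected subgraphs of G containing edges e and f.\<close>
definition conn_ind_containing :: "nat \<Rightarrow> edges \<Rightarrow> nat \<times> nat \<Rightarrow> nat \<times> nat \<Rightarrow> nat set set" where
  "conn_ind_containing n E e f = {W. W \<subseteq> {1..n} \<and> connected_on E W \<and>
      fst e \<in> W \<and> snd e \<in> W \<and> fst f \<in> W \<and> snd f \<in> W}"

definition crossing_closed_pair :: "nat \<Rightarrow> edges \<Rightarrow> nat \<times> nat \<Rightarrow> nat \<times> nat \<Rightarrow> bool" where
  "crossing_closed_pair n E e f \<longleftrightarrow>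
     (\<exists>!W. W \<in> conn_ind_containing n E e f \<and>
        (\<forall>W'\<in>conn_ind_containing n E e f. W' \<subseteq> W \<longrightarrow> W' = W))"

definition crossing_closed :: "nat \<Rightarrow> edges \<Rightarrow> bool" where
  "crossing_closed n E \<longleftrightarrow>
     (\<forall>e\<in>E. \<forall>f\<in>E. crossing e f \<longrightarrow> crossing_closed_pair n E e f)"

text \<open>Vertex set of the connected component of v in the spanning subgraph ([n], S).\<close>
definition component :: "nat \<Rightarrow> edges \<Rightarrow> nat \<Rightarrow> nat set" where
  "component n S v = {u\<in>{1..n}. (v,u) \<in> (S \<union> S\<inverse>)\<^sup>*}"

definition components :: "nat \<Rightarrow> edges \<Rightarrow> nat set set" where
  "components n S = component n S ` {1..n}"

definition is_bond :: "nat \<Rightarrow> edges \<Rightarrow> edges \<Rightarrow> bool" where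
  "is_bond n E S \<longleftrightarrow> S \<subseteq> E \<and>
     (\<forall>B\<in>components n S. induced S B = induced E B)"

definition noncrossing_partition :: "nat set set \<Rightarrow> bool" where
  "noncrossing_partition \<pi> \<longleftrightarrow> (\<forall>B\<in>\<pi>. \<forall>B'\<in>\<pi>. B \<noteq> B' \<longrightarrow>
     \<not> (\<exists>a b c d. a \<in> B \<and> c \<in> B \<and> b \<in> B' \<and> d \<in> B' \<and> a < b \<and> b < c \<and> c < d))"

definition NC :: "nat \<Rightarrow> edges \<Rightarrow> edges set" where
  "NC n E = {S. is_bond n E S \<and> noncrossing_partition (components n S)}"

end

theory Submission
  imports Defs
begin

text \<open>Send a bond to the set of its non-minimal vertices, i.e. the right ends of its edges. On
  noncrossing bonds of a perfectly labeled graph this map is strictly monotone. Noncrossing bonds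
  are closed under intersection because crossing edges lie in a smallest connected induced
  subgraph. The bonds \<open>E\<^sub>k\<close> formed by the edges inside \<open>{1..k}\<close> make up a maximal chain, and the
  map turns meets and joins with \<open>E\<^sub>k\<close> into intersections and unions. For any further chain,
  such a map is a lattice embedding of the generated sublattice into a power set.\<close>

section \<open>Lattices with a set-valued rank function\<close>

lemma poset_trans:
  "poset_on P le \<Longrightarrow> x \<in> P \<Longrightarrow> y \<in> P \<Longrightarrow> z \<in> P \<Longrightarrow> le x y \<Longrightarrow> le y z \<Longrightarrow> le x z"
  unfolding poset_on_def by blast

lemma poset_antisym:
  "poset_on P le \<Longrightarrow> x \<in> P \<Longrightarrow> y \<in> P \<Longrightarrow> le x y \<Longrightarrow> le y x \<Longrightarrow> x = y"
  unfolding poset_on_def by blast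

lemma ljoin_is_lub:
  assumes "finite_lattice P le" "x \<in> P" "y \<in> P"
  shows "is_lub P le x y (ljoin P le x y)"
proof -
  have po: "poset_on P le" using assms(1) by (simp add: finite_lattice_def)
  obtain z where z: "is_lub P le x y z"
    using assms unfolding finite_lattice_def by blast
  have "w = z" if "is_lub P le x y w" for w
    using poset_antisym[OF po] that z unfolding is_lub_def by blast
  then show ?thesis unfolding ljoin_def using z by (rule theI[rotated])
qed

lemma lmeet_is_glb:
  assumes "finite_lattice P le" "x \<in> P" "y \<in> P"
  shows "is_glb P le x y (lmeet P le x y)"
proof -
  have po: "poset_on P le" using assms(1) by (simp add: finite_lattice_def)
  obtain z where z: "is_glb P le x y z"
    using assms unfolding finite_lattice_def by blast
  have "w = z" if "is_glb P le x y w" for w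
    using poset_antisym[OF po] that z unfolding is_glb_def by blast
  then show ?thesis unfolding lmeet_def using z by (rule theI[rotated])
qed

lemma chain_upper:
  assumes "is_chain P le C" "x \<in> C" "y \<in> C" "poset_on P le"
  obtains z where "z \<in> {x, y}" "z \<in> C" "le x z" "le y z"
  using assms unfolding is_chain_def poset_on_def by (metis insertCI subsetD)

lemma chain_lower:
  assumes "is_chain P le C" "x \<in> C" "y \<in> C" "poset_on P le"
  obtains z where "z \<in> {x, y}" "z \<in> C" "le z x" "le z y"
  using assms unfolding is_chain_def poset_on_def by (metis insertCI subsetD)

text \<open>\<open>f\<close> is known to respect only meets and joins with members of
  \<open>M\<close>. The proof enlarges this to a set \<open>S\<close> on which every membership and
  every non-membership in \<open>f x\<close> is certified by a single pair from the two chains.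
  \<open>S\<close> contains both chains, is closed under meet and join, and \<open>f\<close> is
  injective on it, so distributivity is inherited from sets.\<close>

lemma distributive_gen_sublattice:
  fixes f :: "'a \<Rightarrow> 'b set"
  assumes L: "finite_lattice P le"
    and mono: "\<And>x y. x \<in> P \<Longrightarrow> y \<in> P \<Longrightarrow> le x y \<Longrightarrow> f x \<subseteq> f y"
    and strict: "\<And>x y. x \<in> P \<Longrightarrow> y \<in> P \<Longrightarrow> le x y \<Longrightarrow> f x = f y \<Longrightarrow> x = y"
    and M: "is_chain P le M" and C: "is_chain P le C"
    and bot: "b \<in> M" "\<And>x. x \<in> P \<Longrightarrow> le b x"
    and top: "t \<in> M" "\<And>x. x \<in> P \<Longrightarrow> le x t"
    and meet: "\<And>m x. m \<in> M \<Longrightarrow> x \<in> P \<Longrightarrow> f (lmeet P le m x) = f m \<inter> f x"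
    and join: "\<And>m x. m \<in> M \<Longrightarrow> x \<in> P \<Longrightarrow> f (ljoin P le m x) = f m \<union> f x"
  shows "distributive_sub P le (gen_sublattice P le (M \<union> C))"
proof -
  have po: "poset_on P le" using L by (simp add: finite_lattice_def)
  note tr = poset_trans[OF po]
  have refl: "le x x" if "x \<in> P" for x using po that by (simp add: poset_on_def)
  let ?j = "ljoin P le" and ?m = "lmeet P le"
  \<comment> \<open>With the extremes added, each \<open>x\<close> in \<open>M\<close> can be paired
    with a member of \<open>D\<close> without changing it: meet with \<open>t\<close>, join with
    \<open>b\<close>.\<close>
  define D where "D = insert b (insert t C)"
  have MP: "M \<subseteq> P" and CP: "C \<subseteq> P" using M C by (auto simp: is_chain_def)
  have bP: "b \<in> P" and tP: "t \<in> P" using MP bot top by auto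
  have DP: "D \<subseteq> P" unfolding D_def using CP bP tP by auto
  have D: "is_chain P le D"
    using C bot(2) top(2) DP bP tP unfolding is_chain_def D_def by auto
  have j: "?j x y \<in> P" "le x (?j x y)" "le y (?j x y)"
    "\<And>w. w \<in> P \<Longrightarrow> le x w \<Longrightarrow> le y w \<Longrightarrow> le (?j x y) w" if "x \<in> P" "y \<in> P" for x y
    using ljoin_is_lub[OF L that] unfolding is_lub_def by auto
  have m: "?m x y \<in> P" "le (?m x y) x" "le (?m x y) y"
    "\<And>w. w \<in> P \<Longrightarrow> le w x \<Longrightarrow> le w y \<Longrightarrow> le w (?m x y)" if "x \<in> P" "y \<in> P" for x y
    using lmeet_is_glb[OF L that] unfolding is_glb_def by auto
  have jmono: "le (?j x y) (?j x' y')"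
    if "x \<in> P" "y \<in> P" "x' \<in> P" "y' \<in> P" "le x x'" "le y y'" for x y x' y'
    using that by (meson j tr)
  have mmono: "le (?m x y) (?m x' y')"
    if "x \<in> P" "y \<in> P" "x' \<in> P" "y' \<in> P" "le x x'" "le y y'" for x y x' y'
    using that by (meson m tr)
  \<comment> \<open>A certificate is sound by \<open>meet\<close> and monotonicity: \<open>u\<close>
    lies in \<open>f (?m p c)\<close>, hence in \<open>f x\<close> for every \<open>x\<close> above.
    Dually for \<open>up\<close> by \<open>join\<close>.\<close>
  define lo where "lo x u \<longleftrightarrow> (\<exists>p\<in>M. \<exists>c\<in>D. le (?m p c) x \<and> u \<in> f p \<and> u \<in> f c)" for x u
  define up where "up x u \<longleftrightarrow> (\<exists>p\<in>M. \<exists>c\<in>D. le x (?j p c) \<and> u \<notin> f p \<and> u \<notin> f c)" for x u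
  have loD: "u \<in> f x" if "lo x u" "x \<in> P" for x u
    using that MP DP mono[OF m(1)] meet unfolding lo_def by blast
  have upD: "u \<notin> f x" if "up x u" "x \<in> P" for x u
    using that MP DP mono[OF _ j(1)] join unfolding up_def by blast
  have up_join: "up (?j x y) u" if x: "x \<in> P" "up x u" and y: "y \<in> P" "up y u" for x y u
  proof -
    obtain p c where p: "p \<in> M" "c \<in> D" "le x (?j p c)" "u \<notin> f p" "u \<notin> f c"
      using x unfolding up_def by blast
    obtain q d where q: "q \<in> M" "d \<in> D" "le y (?j q d)" "u \<notin> f q" "u \<notin> f d"
      using y unfolding up_def by blast
    \<comment> \<open>Two certificates merge because each factor comes from a chain: the larger of
      \<open>p\<close> and \<open>q\<close> is one of the two, so \<open>u\<close> is still missing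
      from its image.\<close>
    obtain r where r: "r \<in> {p, q}" "r \<in> M" "le p r" "le q r"
      using chain_upper[OF M p(1) q(1) po] by blast
    obtain e where e: "e \<in> {c, d}" "e \<in> D" "le c e" "le d e"
      using chain_upper[OF D p(2) q(2) po] by blast
    have P: "p \<in> P" "c \<in> P" "q \<in> P" "d \<in> P" "r \<in> P" "e \<in> P"
      using p q r e MP DP by auto
    have "le x (?j r e)" using tr[OF x(1) j(1) j(1) p(3) jmono] P r e by blast
    moreover have "le y (?j r e)" using tr[OF y(1) j(1) j(1) q(3) jmono] P r e by blast
    ultimately have "le (?j x y) (?j r e)" by (rule j(4)[OF x(1) y(1) j(1)[OF P(5,6)]])
    then show ?thesis unfolding up_def using r e p q by blast
  qed
  have lo_meet: "lo (?m x y) u" if x: "x \<in> P" "lo x u" and y: "y \<in> P" "lo y u" for x y u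
  proof -
    obtain p c where p: "p \<in> M" "c \<in> D" "le (?m p c) x" "u \<in> f p" "u \<in> f c"
      using x unfolding lo_def by blast
    obtain q d where q: "q \<in> M" "d \<in> D" "le (?m q d) y" "u \<in> f q" "u \<in> f d"
      using y unfolding lo_def by blast
    obtain r where r: "r \<in> {p, q}" "r \<in> M" "le r p" "le r q"
      using chain_lower[OF M p(1) q(1) po] by blast
    obtain e where e: "e \<in> {c, d}" "e \<in> D" "le e c" "le e d"
      using chain_lower[OF D p(2) q(2) po] by blast
    have P: "p \<in> P" "c \<in> P" "q \<in> P" "d \<in> P" "r \<in> P" "e \<in> P"
      using p q r e MP DP by auto
    have "le (?m r e) x" using tr[OF m(1) m(1) x(1) mmono p(3)] P r e by blast
    moreover have "le (?m r e) y" using tr[OF m(1) m(1) y(1) mmono q(3)] P r e by blast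
    ultimately have "le (?m r e) (?m x y)" by (rule m(4)[OF x(1) y(1) m(1)[OF P(5,6)]])
    then show ?thesis unfolding lo_def using r e p q by blast
  qed
  have lo_mono: "lo y u" if "lo x u" "le x y" "x \<in> P" "y \<in> P" for x y u
    using that MP DP tr[OF m(1)] unfolding lo_def by blast
  have up_mono: "up y u" if "up x u" "le y x" "x \<in> P" "y \<in> P" for x y u
    using that MP DP tr[OF _ _ j(1)] unfolding up_def by blast
  define S where "S = {x \<in> P. (\<forall>u. (u \<in> f x \<longrightarrow> lo x u) \<and> (u \<notin> f x \<longrightarrow> up x u))}"
  have Sj: "?j x y \<in> S" "f (?j x y) = f x \<union> f y" if "x \<in> S" "y \<in> S" for x y
  proof -
    have xy: "x \<in> P" "y \<in> P" using that by (auto simp: S_def)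
    note J = j[OF xy]
    have 1: "up (?j x y) u" if "u \<notin> f x" "u \<notin> f y" for u
      using up_join xy that \<open>x \<in> S\<close> \<open>y \<in> S\<close> by (auto simp: S_def)
    have 2: "lo (?j x y) u" if "u \<in> f x \<union> f y" for u
      using lo_mono[OF _ J(2) xy(1) J(1)] lo_mono[OF _ J(3) xy(2) J(1)] that \<open>x \<in> S\<close> \<open>y \<in> S\<close>
      by (auto simp: S_def)
    show eq: "f (?j x y) = f x \<union> f y" using 1 2 upD loD J(1) by blast
    show "?j x y \<in> S" unfolding S_def using 1 2 eq J by blast
  qed
  have Sm: "?m x y \<in> S" "f (?m x y) = f x \<inter> f y" if "x \<in> S" "y \<in> S" for x y
  proof -
    have xy: "x \<in> P" "y \<in> P" using that by (auto simp: S_def)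
    note J = m[OF xy]
    have 1: "lo (?m x y) u" if "u \<in> f x" "u \<in> f y" for u
      using lo_meet xy that \<open>x \<in> S\<close> \<open>y \<in> S\<close> by (auto simp: S_def)
    have 2: "up (?m x y) u" if "u \<notin> f x \<or> u \<notin> f y" for u
      using up_mono[OF _ J(2) xy(1) J(1)] up_mono[OF _ J(3) xy(2) J(1)] that \<open>x \<in> S\<close> \<open>y \<in> S\<close>
      by (auto simp: S_def)
    show eq: "f (?m x y) = f x \<inter> f y" using 1 2 upD loD J(1) by blast
    show "?m x y \<in> S" unfolding S_def using 1 2 eq J by blast
  qed
  have bnd: "f b \<subseteq> f x" "f x \<subseteq> f t" if "x \<in> P" for x
    using mono bot(2) top(2) bP tP that by auto
  have bt: "b \<in> D" "t \<in> D" by (auto simp: D_def)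
  have MS: "M \<subseteq> S"
  proof
    fix x assume x: "x \<in> M"
    then have xP: "x \<in> P" using MP by auto
    have "lo x u" if "u \<in> f x" for u
      using that x m(2)[OF xP tP] bnd(2)[OF xP] bt unfolding lo_def by blast
    moreover have "up x u" if "u \<notin> f x" for u
      using that x j(2)[OF xP bP] bnd(1)[OF xP] bt unfolding up_def by blast
    ultimately show "x \<in> S" unfolding S_def using xP by blast
  qed
  have CS: "C \<subseteq> S"
  proof
    fix x assume x: "x \<in> C"
    then have xP: "x \<in> P" and xD: "x \<in> D" using CP by (auto simp: D_def)
    have "lo x u" if "u \<in> f x" for u
      using that xD top(1) m(3)[OF tP xP] bnd(2)[OF xP] unfolding lo_def by blast
    moreover have "up x u" if "u \<notin> f x" for u
      using that xD bot(1) j(3)[OF bP xP] bnd(1)[OF xP] unfolding up_def by blast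
    ultimately show "x \<in> S" unfolding S_def using xP by blast
  qed
  have SP: "S \<subseteq> P" unfolding S_def by auto
  have gen: "gen_sublattice P le (M \<union> C) \<subseteq> S"
    unfolding gen_sublattice_def using MS CS SP Sj Sm by (intro Inter_lower) auto
  have inj: "x = y" if "x \<in> S" "y \<in> S" "f x = f y" for x y
  proof -
    have xy: "x \<in> P" "y \<in> P" using that SP by auto
    \<comment> \<open>\<open>strict\<close> applies only to comparable elements, so equality is
      reached through the meet, which lies below both.\<close>
    have "f (?m x y) = f x" "f (?m x y) = f y" using Sm(2) that by auto
    then have "?m x y = x" "?m x y = y" using strict m[OF xy] xy by blast+
    then show ?thesis by simp
  qed
  \<comment> \<open>Under \<open>f\<close> this becomes the distributive law for intersection and
    union.\<close>
  have "?m x (?j y z) = ?j (?m x y) (?m x z)" if "x \<in> S" "y \<in> S" "z \<in> S" for x y z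
    using that by (intro inj) (auto simp: Sj Sm)
  then show ?thesis unfolding distributive_sub_def using gen by blast
qed

section \<open>Connectivity in perfectly labeled graphs\<close>

definition linked :: "edges \<Rightarrow> (nat \<times> nat) set" where
  "linked S = (S \<union> S\<inverse>)\<^sup>*"

text \<open>In a graph the second entry is the larger end, so bounding it bounds both ends;
  \<open>edges_upto E k\<close> is the chain element \<open>E\<^sub>k\<close>.\<close>

definition edges_upto :: "edges \<Rightarrow> nat \<Rightarrow> edges" where
  "edges_upto S k = {e \<in> S. snd e \<le> k}"

lemma perfectly_labeledD:
  "perfectly_labeled S \<Longrightarrow> (i, k) \<in> S \<Longrightarrow> (j, k) \<in> S \<Longrightarrow> i < j \<Longrightarrow> j < k \<Longrightarrow> (i, j) \<in> S"
  unfolding perfectly_labeled_def by blast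

lemma linked_refl [simp]: "(x, x) \<in> linked S"
  by (simp add: linked_def)

lemma linked_sym: "(x, y) \<in> linked S \<Longrightarrow> (y, x) \<in> linked S"
  unfolding linked_def using sym_rtrancl[OF sym_Un_converse] by (rule symD)

lemma linked_trans: "(x, y) \<in> linked S \<Longrightarrow> (y, z) \<in> linked S \<Longrightarrow> (x, z) \<in> linked S"
  unfolding linked_def by (rule rtrancl_trans)

lemma linked_edge: "(x, y) \<in> S \<Longrightarrow> (x, y) \<in> linked S"
  unfolding linked_def by auto

lemma linked_edge': "(x, y) \<in> S \<Longrightarrow> (y, x) \<in> linked S"
  unfolding linked_def by auto

lemma linked_step: "(x, y) \<in> linked S \<Longrightarrow> (y, z) \<in> S \<or> (z, y) \<in> S \<Longrightarrow> (x, z) \<in> linked S"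
  using linked_trans linked_edge linked_edge' by blast

lemma linked_common: "(v, x) \<in> linked S \<Longrightarrow> (v, y) \<in> linked S \<Longrightarrow> (x, y) \<in> linked S"
  using linked_trans linked_sym by blast

lemma linked_mono: "S \<subseteq> T \<Longrightarrow> linked S \<subseteq> linked T"
  unfolding linked_def by (intro rtrancl_mono) auto

lemma linked_subset_linked:
  assumes "S \<subseteq> linked T"
  shows "linked S \<subseteq> linked T"
proof -
  have "S \<union> S\<inverse> \<subseteq> linked T" using assms linked_sym by auto
  then show ?thesis unfolding linked_def using rtrancl_subset_rtrancl by blast
qed

lemma linked_induct [consumes 1, case_names base step]:
  assumes "(x, y) \<in> linked S" "Q x"
    and "\<And>y z. (x, y) \<in> linked S \<Longrightarrow> (y, z) \<in> S \<or> (z, y) \<in> S \<Longrightarrow> Q y \<Longrightarrow> Q z"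
  shows "Q y"
  using assms(1) unfolding linked_def
proof (induction rule: rtrancl_induct)
  case base then show ?case by (rule assms(2))
next
  case (step y z)
  then show ?case using assms(3)[of y z] by (auto simp: linked_def)
qed

lemma linked_exit:
  assumes "(x, y) \<in> linked S" "Q x" "\<not> Q y"
  obtains u v where "(x, u) \<in> linked S" "(u, v) \<in> S \<or> (v, u) \<in> S" "Q u" "\<not> Q v"
proof -
  have "Q y" if "\<nexists>u v. (x, u) \<in> linked S \<and> ((u, v) \<in> S \<or> (v, u) \<in> S) \<and> Q u \<and> \<not> Q v"
    using assms(1,2)
  proof (induction rule: linked_induct)
    case (step y z)
    then show ?case using that by blast
  qed
  then show ?thesis using that assms(3) by blast
qed

text \<open>The largest vertex can be removed from a path: replace it by a fixed smaller neighbour.\<close>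
lemma linked_upto_Suc:
  assumes lt: "\<And>i j. (i, j) \<in> S \<Longrightarrow> i < j" and pl: "perfectly_labeled S"
    and uv: "(u, v) \<in> linked (edges_upto S (Suc k))" "u \<le> k" "v \<le> k"
  shows "(u, v) \<in> linked (edges_upto S k)"
proof (cases "\<exists>h. (h, Suc k) \<in> S")
  case False
  then have "edges_upto S (Suc k) = edges_upto S k" unfolding edges_upto_def by (auto simp: le_Suc_eq)
  then show ?thesis using uv by simp
next
  case True
  then obtain h where h: "(h, Suc k) \<in> S" by blast
  define g where "g x = (if x = Suc k then h else x)" for x
  \<comment> \<open>Two distinct left neighbours of \<open>Suc k\<close> are adjacent by perfect
    labeling, and the edge between them ends at or before \<open>k\<close>.\<close>
  have nb: "(x, h) \<in> linked (edges_upto S k)" if "(x, Suc k) \<in> S" for x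
  proof -
    have "x < Suc k" "h < Suc k" using that h lt by auto
    then have "x = h \<or> (x, h) \<in> edges_upto S k \<or> (h, x) \<in> edges_upto S k"
      using that h perfectly_labeledD[OF pl, of x "Suc k" h] perfectly_labeledD[OF pl, of h "Suc k" x]
      by (cases x h rule: linorder_cases) (auto simp: edges_upto_def)
    then show ?thesis using linked_edge linked_edge' by auto
  qed
  have edge: "(g x, g y) \<in> linked (edges_upto S k)" if "(x, y) \<in> edges_upto S (Suc k)" for x y
  proof -
    have "(x, y) \<in> S" "y \<le> Suc k" "x < y" using that lt by (auto simp: edges_upto_def)
    then show ?thesis
      using nb linked_edge[of x y "edges_upto S k"]
      by (cases "y = Suc k") (auto simp: g_def edges_upto_def)
  qed
  from uv(1) have "(g u, g v) \<in> linked (edges_upto S k)"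
  proof (induction rule: linked_induct)
    case (step y z)
    then show ?case using edge linked_sym linked_trans by blast
  qed simp
  then show ?thesis using uv by (simp add: g_def)
qed

text \<open>Vertices are deleted one at a time from \<open>n\<close> down to \<open>k+1\<close>,
  each deletion preserving connection among the smaller vertices.\<close>

lemma linked_upto:
  assumes lt: "\<And>i j. (i, j) \<in> S \<Longrightarrow> i < j \<and> j \<le> n" and pl: "perfectly_labeled S"
    and uv: "(u, v) \<in> linked S" "u \<le> k" "v \<le> k"
  shows "(u, v) \<in> linked (edges_upto S k)"
proof (cases "k \<le> n")
  case True
  then show ?thesis using uv(2,3)
  proof (induction rule: inc_induct)
    case base
    have "edges_upto S n = S" using lt by (auto simp: edges_upto_def)
    then show ?case using uv by simp
  next
    case (step m)
    then have "(u, v) \<in> linked (edges_upto S (Suc m))" by simp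
    then show ?case using linked_upto_Suc[OF _ pl] lt step.prems by blast
  qed
next
  case False
  then have "edges_upto S k = S" using lt by (fastforce simp: edges_upto_def)
  then show ?thesis using uv by simp
qed

text \<open>The path from \<open>j\<close> to the smaller \<open>i\<close> can be kept inside the
  vertices up to \<open>j\<close>, so the edge on which it leaves \<open>j\<close> goes down. Hence
  \<open>snd\<close> applied to the edges yields exactly the non-minimal vertices of the
  blocks.\<close>

lemma linked_lower_neighbour:
  assumes lt: "\<And>i j. (i, j) \<in> S \<Longrightarrow> i < j \<and> j \<le> n" and pl: "perfectly_labeled S"
    and ij: "(i, j) \<in> linked S" "i < j"
  shows "j \<in> snd ` S"
proof -
  have "(j, i) \<in> linked (edges_upto S j)" using linked_upto[OF lt pl ij(1)] ij(2) linked_sym by auto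
  then obtain v where "(j, v) \<in> edges_upto S j \<or> (v, j) \<in> edges_upto S j"
    using linked_exit[of j i "edges_upto S j" "\<lambda>x. x = j"] ij(2) by blast
  then show ?thesis using lt by (force simp: edges_upto_def)
qed

lemma linked_upto_bound:
  assumes lt: "\<And>i j. (i, j) \<in> S \<Longrightarrow> i < j"
    and "(i, j) \<in> linked (edges_upto S k)" "i \<noteq> j"
  shows "j \<le> k"
  using assms(2,3)
proof (induction rule: linked_induct)
  case (step y z)
  then show ?case using lt by (fastforce simp: edges_upto_def)
qed simp

section \<open>Noncrossing bonds\<close>

text \<open>The bond condition stated through connectivity alone, without blocks or
  \<open>n\<close>; on a graph it agrees with \<open>is_bond\<close>.\<close>

definition bond_closed :: "edges \<Rightarrow> edges \<Rightarrow> bool" where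
  "bond_closed E S \<longleftrightarrow> S \<subseteq> E \<and> E \<inter> linked S \<subseteq> S"

text \<open>Only pairs of crossing edges are tested, not arbitrary vertices of two blocks;
  \<open>noncrossing_partition_iff\<close> shows that this suffices.\<close>

definition noncrossing_edges :: "edges \<Rightarrow> bool" where
  "noncrossing_edges S \<longleftrightarrow> (\<forall>a b c d. (a, c) \<in> S \<and> (b, d) \<in> S \<and> a < b \<and> b < c \<and> c < d
     \<longrightarrow> (a, b) \<in> linked S)"

lemma noncrossing_partitionD:
  assumes "noncrossing_partition \<pi>" "B \<in> \<pi>" "B' \<in> \<pi>"
    "a \<in> B" "c \<in> B" "b \<in> B'" "d \<in> B'" "a < b" "b < c" "c < d"
  shows "B = B'"
  using assms unfolding noncrossing_partition_def by meson

lemma component_eq: "component n S v = {u \<in> {1..n}. (v, u) \<in> linked S}"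
  by (simp add: component_def linked_def)

lemma is_bond_iff:
  assumes "graph_on n E"
  shows "is_bond n E S \<longleftrightarrow> bond_closed E S"
proof
  assume S: "is_bond n E S"
  have "(i, j) \<in> S" if ij: "(i, j) \<in> E" "(i, j) \<in> linked S" for i j
  proof -
    have v: "i \<in> {1..n}" "j \<in> {1..n}" using assms ij by (auto simp: graph_on_def)
    then have "induced S (component n S i) = induced E (component n S i)"
      using S by (auto simp: is_bond_def components_def)
    moreover have "(i, j) \<in> induced E (component n S i)"
      using ij v by (auto simp: induced_def component_eq)
    ultimately show ?thesis by (auto simp: induced_def)
  qed
  then show "bond_closed E S" using S by (auto simp: bond_closed_def is_bond_def)
next
  assume S: "bond_closed E S"
  have "(i, j) \<in> S" if "(i, j) \<in> E" "i \<in> component n S v" "j \<in> component n S v" for i j v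
    using that S linked_common[of v i S j] unfolding component_eq bond_closed_def by blast
  then show "is_bond n E S"
    using S by (fastforce simp: is_bond_def bond_closed_def components_def induced_def)
qed

text \<open>The substance is that two crossing blocks contain two crossing edges. A path in one
  block yields a chord separating two vertices of the other block, and a path between those two must
  then cross the chord.\<close>

lemma noncrossing_partition_iff:
  assumes lt: "\<And>i j. (i, j) \<in> S \<Longrightarrow> 1 \<le> i \<and> i < j \<and> j \<le> n"
  shows "noncrossing_partition (components n S) \<longleftrightarrow> noncrossing_edges S"
proof
  assume L: "noncrossing_partition (components n S)"
  show "noncrossing_edges S" unfolding noncrossing_edges_def
  proof (intro allI impI)
    fix a b c d assume *: "(a, c) \<in> S \<and> (b, d) \<in> S \<and> a < b \<and> b < c \<and> c < d"
    then have v: "a \<in> {1..n}" "b \<in> {1..n}" "c \<in> {1..n}" "d \<in> {1..n}"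
      using lt[of a c] lt[of b d] by auto
    then have comps: "component n S a \<in> components n S" "component n S b \<in> components n S"
      by (auto simp: components_def)
    have mem: "a \<in> component n S a" "c \<in> component n S a"
      "b \<in> component n S b" "d \<in> component n S b"
      using * v by (auto simp: component_eq linked_edge)
    have "component n S a = component n S b"
      using noncrossing_partitionD[OF L comps mem] * by blast
    then have "b \<in> component n S a" using mem(3) by simp
    then show "(a, b) \<in> linked S" by (simp add: component_eq)
  qed
next
  assume R: "noncrossing_edges S"
  have linked4: "(x, y) \<in> linked S"
    if "(x, z) \<in> S" "(y, w) \<in> S" "x < y \<and> y < z \<and> z < w \<or> y < x \<and> x < w \<and> w < z" for x y z w
    using that R linked_sym unfolding noncrossing_edges_def by blast
  show "noncrossing_partition (components n S)" unfolding noncrossing_partition_def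
  proof (intro ballI impI notI, elim exE conjE)
    fix B B' a b c d
    assume B: "B \<in> components n S" "B' \<in> components n S" "B \<noteq> B'"
      and mem: "a \<in> B" "c \<in> B" "b \<in> B'" "d \<in> B'" and ord: "a < b" "b < c" "c < d"
    have ac: "(a, c) \<in> linked S" and bd: "(b, d) \<in> linked S"
      using B mem unfolding components_def component_eq by (auto intro: linked_common)
    have ab: "(a, b) \<notin> linked S"
    proof
      assume ab: "(a, b) \<in> linked S"
      obtain v v' where v: "B = component n S v" "B' = component n S v'"
        using B by (auto simp: components_def)
      have vv: "(v, v') \<in> linked S"
        using linked_trans[OF _ linked_trans[OF ab linked_sym]] mem(1,3) v
        by (simp add: component_eq)
      have "(v, u) \<in> linked S \<longleftrightarrow> (v', u) \<in> linked S" for u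
        using linked_common[OF vv] linked_trans[OF vv] by blast
      then have "B = B'" by (simp add: v component_eq)
      then show False using B by simp
    qed
    \<comment> \<open>Vertices of different blocks never coincide, which makes all later comparisons
      strict.\<close>
    have sep: "x \<noteq> y" if "(a, x) \<in> linked S" "(b, y) \<in> linked S" for x y
    proof
      assume "x = y"
      then have "(x, b) \<in> linked S" using linked_sym[OF that(2)] by simp
      then show False using linked_trans[OF that(1)] ab by blast
    qed
    \<comment> \<open>\<open>c\<close> lies between \<open>b\<close> and \<open>d\<close> while
      \<open>a\<close> does not, so some edge of the path from \<open>c\<close> to \<open>a\<close>
      leaves this interval.\<close>
    obtain x z where xz: "(c, x) \<in> linked S" "(x, z) \<in> S \<or> (z, x) \<in> S"
      "b < x \<and> x < d" "\<not> (b < z \<and> z < d)"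
      using linked_exit[OF linked_sym[OF ac], of "\<lambda>x. b < x \<and> x < d"] ord by auto
    have ax: "(a, x) \<in> linked S" by (rule linked_trans[OF ac xz(1)])
    have az: "(a, z) \<in> linked S" using linked_step[OF ax xz(2)] .
    define p q where "p = min x z" and "q = max x z"
    have pq: "(p, q) \<in> S" using xz(2) lt[of x z] lt[of z x]
      by (cases x z rule: linorder_cases) (auto simp: p_def q_def)
    have apq: "(a, p) \<in> linked S" "(a, q) \<in> linked S"
      using ax az by (auto simp: p_def q_def min_def max_def)
    have ne: "z \<noteq> b" "z \<noteq> d" using sep az bd by auto
    \<comment> \<open>One end of the chord is strictly between \<open>b\<close> and \<open>d\<close>
      and the other strictly outside, so the chord has exactly one of \<open>b\<close> and
      \<open>d\<close> under it.\<close>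
    have side: "(p < b \<and> b < q) \<noteq> (p < d \<and> d < q)"
      using xz(3,4) ne by (auto simp: p_def q_def min_def max_def split: if_splits)
    define Q where "Q v \<longleftrightarrow> p < v \<and> v < q" for v
    have "Q b \<noteq> Q d" using side by (simp add: Q_def)
    \<comment> \<open>The path from \<open>b\<close> to \<open>d\<close> changes sides of the chord;
      the edge where it does so will cross \<open>(p, q)\<close>. The case split only orients the
      side from which \<open>linked_exit\<close> starts.\<close>
    obtain y w where yw: "(b, y) \<in> linked S" "(y, w) \<in> S \<or> (w, y) \<in> S" "Q y \<noteq> Q w"
    proof (cases "Q b")
      case True
      then have "\<not> Q d" using \<open>Q b \<noteq> Q d\<close> by simp
      show ?thesis by (rule linked_exit[OF bd True \<open>\<not> Q d\<close>]) (rule that, auto)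
    next
      case False
      then have "\<not> \<not> Q d" using \<open>Q b \<noteq> Q d\<close> by simp
      show ?thesis by (rule linked_exit[OF bd, of "\<lambda>v. \<not> Q v", OF False \<open>\<not> \<not> Q d\<close>]) (rule that, auto)
    qed
    have bw: "(b, w) \<in> linked S" using linked_step[OF yw(1,2)] .
    have ne2: "y \<noteq> p" "y \<noteq> q" "w \<noteq> p" "w \<noteq> q" using sep apq yw(1) bw by blast+
    have "p < q" using lt[OF pq] by simp
    define r s where "r = min y w" and "s = max y w"
    have rs: "(r, s) \<in> S" using yw(2) lt[of y w] lt[of w y]
      by (cases y w rule: linorder_cases) (auto simp: r_def s_def)
    have br: "(b, r) \<in> linked S" using yw(1) bw by (auto simp: r_def min_def)
    have "p < r \<and> r < q \<and> q < s \<or> r < p \<and> p < s \<and> s < q"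
      using yw(3) ne2 \<open>p < q\<close> by (auto simp: Q_def r_def s_def min_def max_def split: if_splits)
    then have "(p, r) \<in> linked S" using linked4[OF pq rs] by blast
    then show False using sep[OF linked_trans[OF apq(1)] br] by blast
  qed
qed

lemma NC_iff:
  assumes "graph_on n E"
  shows "S \<in> NC n E \<longleftrightarrow> bond_closed E S \<and> noncrossing_edges S"
proof -
  have "noncrossing_partition (components n S) \<longleftrightarrow> noncrossing_edges S" if "S \<subseteq> E"
    by (rule noncrossing_partition_iff) (use that assms in \<open>auto simp: graph_on_def\<close>)
  then show ?thesis
    unfolding NC_def is_bond_iff[OF assms] by (auto simp: bond_closed_def)
qed

text \<open>Although phrased with edges, the property depends only on the blocks. It can therefore
  be checked on a plain union and transferred to its bond closure.\<close>

lemma noncrossing_edges_cong: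
  assumes "linked S = linked T"
    and "\<And>i j. (i, j) \<in> S \<Longrightarrow> 1 \<le> i \<and> i < j \<and> j \<le> n"
    and "\<And>i j. (i, j) \<in> T \<Longrightarrow> 1 \<le> i \<and> i < j \<and> j \<le> n"
  shows "noncrossing_edges S \<longleftrightarrow> noncrossing_edges T"
proof -
  have "components n S = components n T"
    using assms(1) by (simp add: components_def component_eq cong: image_cong)
  then show ?thesis
    using noncrossing_partition_iff[of S n] noncrossing_partition_iff[of T n] assms by metis
qed

section \<open>Strict monotonicity of the set of right ends on bonds\<close>

lemma bond_perfectly_labeled:
  assumes "perfectly_labeled E" "bond_closed E S"
  shows "perfectly_labeled S"
  unfolding perfectly_labeled_def
proof (intro allI impI, elim conjE)
  fix i j k assume ijk: "i < j" "j < k" "(i, k) \<in> S" "(j, k) \<in> S"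
  then have "(i, j) \<in> E"
    using perfectly_labeledD[OF assms(1)] assms(2) unfolding bond_closed_def by blast
  moreover have "(i, j) \<in> linked S" using linked_step[OF linked_edge[OF ijk(3)]] ijk(4) by blast
  ultimately show "(i, j) \<in> S" using assms by (auto simp: bond_closed_def)
qed

text \<open>Induction on the right end \<open>k\<close> of an edge \<open>(i, k)\<close> of
  \<open>T\<close>. Since \<open>k\<close> is also a right end in \<open>S\<close>, it has a left
  neighbour \<open>j\<close> there; perfect labeling makes \<open>i\<close> and \<open>j\<close>
  equal or adjacent in \<open>T\<close>, and an edge between them ends before \<open>k\<close>, so
  it is in \<open>S\<close>. Thus \<open>S\<close> links \<open>i\<close> to \<open>k\<close> and,
  being a bond, contains the edge.\<close>

lemma bond_eq_if_snd_image_eq: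
  assumes lt: "\<And>i j. (i, j) \<in> E \<Longrightarrow> i < j" and pl: "perfectly_labeled E"
    and S: "bond_closed E S" and T: "bond_closed E T" and "S \<subseteq> T" and eq: "snd ` S = snd ` T"
  shows "S = T"
proof -
  have plT: "perfectly_labeled T" using bond_perfectly_labeled[OF pl T] .
  have TE: "T \<subseteq> E" using T by (simp add: bond_closed_def)
  have "(i, k) \<in> S" if "(i, k) \<in> T" for i k
    using that
  proof (induction k arbitrary: i rule: less_induct)
    case (less k)
    have "k \<in> snd ` S" unfolding eq using less.prems by force
    then obtain j where j: "(j, k) \<in> S" by auto
    have "i < k" "j < k" using lt less.prems j TE \<open>S \<subseteq> T\<close> by blast+
    have "(i, j) \<in> linked S"
    proof (cases i j rule: linorder_cases)
      case less': less
      then have "(i, j) \<in> T"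
        using perfectly_labeledD[OF plT less.prems] j \<open>S \<subseteq> T\<close> \<open>j < k\<close> by blast
      then show ?thesis using less.IH \<open>j < k\<close> linked_edge by blast
    next
      case greater
      then have "(j, i) \<in> T"
        using perfectly_labeledD[OF plT _ less.prems] j \<open>S \<subseteq> T\<close> \<open>i < k\<close> by blast
      then show ?thesis using less.IH \<open>i < k\<close> linked_edge' by blast
    qed simp
    then have "(i, k) \<in> linked S" using j linked_edge linked_trans by blast
    then show ?case using S TE less.prems by (auto simp: bond_closed_def)
  qed
  then show ?thesis using \<open>S \<subseteq> T\<close> by auto
qed

section \<open>Crossing closed graphs\<close>

lemma connected_on_component:
  assumes "v \<in> {1..n}" "S \<subseteq> E" and lt: "\<And>i j. (i, j) \<in> S \<Longrightarrow> 1 \<le> i \<and> i < j \<and> j \<le> n"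
  shows "connected_on E (component n S v)"
proof -
  let ?W = "component n S v"
  have "(v, u) \<in> linked (induced E ?W)" if "(v, u) \<in> linked S" for u
    using that
  proof (induction rule: linked_induct)
    case (step y z)
    have vz: "(v, z) \<in> linked S" using linked_step[OF step(1,2)] .
    have "y \<in> {1..n}" "z \<in> {1..n}" using step(2) lt[of y z] lt[of z y] by auto
    then have "y \<in> ?W" "z \<in> ?W" using step vz by (auto simp: component_eq)
    then have "(y, z) \<in> induced E ?W \<or> (z, y) \<in> induced E ?W"
      using step(2) \<open>S \<subseteq> E\<close> unfolding induced_def by blast
    with step(3) show ?case by (rule linked_step)
  qed simp
  then have "(u, w) \<in> linked (induced E ?W)" if "u \<in> ?W" "w \<in> ?W" for u w
    using that by (intro linked_common[of v u _ w]) (auto simp: component_eq)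
  moreover have "v \<in> ?W" using assms by (auto simp: component_eq)
  ultimately show ?thesis unfolding connected_on_def linked_def by blast
qed

text \<open>The family is finite, so each member contains a minimal one; as the minimal member is
  unique, it lies inside all others.\<close>

lemma crossing_closed_least:
  assumes "crossing_closed n E" "(a, c) \<in> E" "(b, d) \<in> E" "a < b" "b < c" "c < d"
  obtains W where "connected_on E W" "a \<in> W" "b \<in> W"
    "\<And>W'. W' \<in> conn_ind_containing n E (a, c) (b, d) \<Longrightarrow> W \<subseteq> W'"
proof -
  let ?F = "conn_ind_containing n E (a, c) (b, d)"
  have "crossing (a, c) (b, d)" using assms by (simp add: crossing_def)
  then have "crossing_closed_pair n E (a, c) (b, d)"
    using assms unfolding crossing_closed_def by blast
  moreover define Q where "Q W \<longleftrightarrow> W \<in> ?F \<and> (\<forall>W'\<in>?F. W' \<subseteq> W \<longrightarrow> W' = W)" for W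
  ultimately have "\<exists>!W. Q W" by (simp add: crossing_closed_pair_def)
  then obtain W where W: "Q W" and uniq: "\<And>V. Q V \<Longrightarrow> V = W" by (elim ex1E) blast
  have fin: "finite ?F"
    by (rule finite_subset[of _ "Pow {1..n}"]) (auto simp: conn_ind_containing_def)
  have least: "W \<subseteq> W'" if "W' \<in> ?F" for W'
  proof -
    obtain V where V: "V \<in> ?F" "V \<subseteq> W'" "\<forall>U\<in>?F. U \<subseteq> V \<longrightarrow> V = U"
      using finite_has_minimal2[OF fin \<open>W' \<in> ?F\<close>] by blast
    have "Q V" unfolding Q_def using V(1,3) by metis
    then show ?thesis using uniq V(2) by blast
  qed
  have "W \<in> ?F" using W by (simp add: Q_def)
  then have "connected_on E W" "a \<in> W" "b \<in> W" by (auto simp: conn_ind_containing_def)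
  then show ?thesis by (rule that[OF _ _ _ least])
qed

section \<open>The bonds \<open>E\<^sub>k\<close>, intersections of noncrossing bonds, and joins
  with \<open>E\<^sub>k\<close>\<close>

lemma connected_on_linked:
  "connected_on E W \<Longrightarrow> u \<in> W \<Longrightarrow> v \<in> W \<Longrightarrow> (u, v) \<in> linked (induced E W)"
  by (simp add: connected_on_def linked_def)

text \<open>Crossing closedness provides a connected set through both edges, hence a path from
  \<open>a\<close> to \<open>b\<close> in \<open>E\<close>. Both vertices are below
  \<open>c\<close>, so the path can be pushed down to \<open>{1..k}\<close> even when
  \<open>d\<close> exceeds \<open>k\<close>.\<close>

lemma crossing_linked_upto:
  assumes G: "graph_on n E" and pl: "perfectly_labeled E" and cc: "crossing_closed n E"
    and e: "(a, c) \<in> E" "(b, d) \<in> E" "a < b" "b < c" "c < d" and "c \<le> k"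
  shows "(a, b) \<in> linked (edges_upto E k)"
proof -
  obtain W where "connected_on E W" "a \<in> W" "b \<in> W"
    using crossing_closed_least[OF cc e] by blast
  then have "(a, b) \<in> linked (induced E W)" by (rule connected_on_linked)
  then have "(a, b) \<in> linked E"
    using linked_mono[of "induced E W" E] by (auto simp: induced_def)
  then show ?thesis
    using linked_upto[OF _ pl, of n a b k] G e \<open>c \<le> k\<close> by (auto simp: graph_on_def)
qed

lemma between_insert: "A \<subseteq> X \<Longrightarrow> X \<subseteq> B \<Longrightarrow> B \<subseteq> insert c A \<Longrightarrow> X = A \<or> X = B"
  by blast

lemma upto_in_NC:
  assumes G: "graph_on n E" and pl: "perfectly_labeled E" and cc: "crossing_closed n E"
  shows "edges_upto E k \<in> NC n E"
  unfolding NC_iff[OF G]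
proof
  have lt: "i < j" if "(i, j) \<in> E" for i j using G that by (auto simp: graph_on_def)
  have "(i, j) \<in> edges_upto E k" if "(i, j) \<in> E" "(i, j) \<in> linked (edges_upto E k)" for i j
    using that linked_upto_bound[OF lt that(2)] lt[OF that(1)] by (auto simp: edges_upto_def)
  then show "bond_closed E (edges_upto E k)"
    by (auto simp: bond_closed_def) (auto simp: edges_upto_def)
  show "noncrossing_edges (edges_upto E k)"
    unfolding noncrossing_edges_def
    using crossing_linked_upto[OF G pl cc] by (fastforce simp: edges_upto_def)
qed

text \<open>In a noncrossing bond two crossing edges share a block, which is a connected set
  containing both and so contains the least such set \<open>W\<close>. The edges of \<open>E\<close>
  inside \<open>W\<close> then lie in \<open>S\<close> and in \<open>T\<close>, and they already
  link \<open>a\<close> to \<open>b\<close>.\<close>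

lemma Int_in_NC:
  assumes G: "graph_on n E" and cc: "crossing_closed n E"
    and S: "S \<in> NC n E" and T: "T \<in> NC n E"
  shows "S \<inter> T \<in> NC n E"
  unfolding NC_iff[OF G]
proof
  have bS: "bond_closed E S" and bT: "bond_closed E T"
    using S T by (auto simp: NC_iff[OF G])
  show "bond_closed E (S \<inter> T)"
    using bS bT linked_mono[of "S \<inter> T" S] linked_mono[of "S \<inter> T" T]
    unfolding bond_closed_def by blast
  show "noncrossing_edges (S \<inter> T)"
    unfolding noncrossing_edges_def
  proof (intro allI impI, elim conjE)
    fix a b c d assume e: "(a, c) \<in> S \<inter> T" "(b, d) \<in> S \<inter> T" "a < b" "b < c" "c < d"
    have eE: "(a, c) \<in> E" "(b, d) \<in> E" using e bS by (auto simp: bond_closed_def)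
    have v: "a \<in> {1..n}" "b \<in> {1..n}" "c \<in> {1..n}" "d \<in> {1..n}"
      using G eE by (auto simp: graph_on_def)
    have comp: "component n R a \<in> conn_ind_containing n E (a, c) (b, d)"
      if R: "R \<in> NC n E" "(a, c) \<in> R" "(b, d) \<in> R" for R
    proof -
      have ab: "(a, b) \<in> linked R"
        using R e(3-5) unfolding NC_iff[OF G] noncrossing_edges_def by blast
      have "R \<subseteq> E" using R by (auto simp: NC_iff[OF G] bond_closed_def)
      then have "connected_on E (component n R a)"
        using G v(1) by (intro connected_on_component) (auto simp: graph_on_def)
      then show ?thesis
        using v ab linked_trans[OF ab linked_edge[OF R(3)]] linked_edge[OF R(2)]
        by (auto simp: conn_ind_containing_def component_eq)
    qed
    obtain W where W: "connected_on E W" "a \<in> W" "b \<in> W"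
      "\<And>W'. W' \<in> conn_ind_containing n E (a, c) (b, d) \<Longrightarrow> W \<subseteq> W'"
      using crossing_closed_least[OF cc eE e(3-5)] by blast
    have "induced E W \<subseteq> R" if R: "R \<in> NC n E" "(a, c) \<in> R" "(b, d) \<in> R" for R
    proof -
      have "W \<subseteq> component n R a" using W(4) comp R by blast
      then have "(i, j) \<in> linked R" if "i \<in> W" "j \<in> W" for i j
        using that linked_common unfolding component_eq by blast
      then show ?thesis using R by (auto simp: NC_iff[OF G] bond_closed_def induced_def)
    qed
    then have "induced E W \<subseteq> S \<inter> T" using S T e by auto
    then show "(a, b) \<in> linked (S \<inter> T)"
      using linked_mono connected_on_linked[OF W(1-3)] by blast
  qed
qed

text \<open>The witness is the bond closure of the union, which needs no further merging of blocks.\<close>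
lemma upper_bound_with_upto:
  assumes G: "graph_on n E" and pl: "perfectly_labeled E" and cc: "crossing_closed n E"
    and S: "S \<in> NC n E"
  obtains T where "T \<in> NC n E" "S \<subseteq> T" "edges_upto E k \<subseteq> T"
    "snd ` T \<subseteq> snd ` S \<union> snd ` edges_upto E k"
proof -
  have bS: "bond_closed E S" and nS: "noncrossing_edges S" using S by (auto simp: NC_iff[OF G])
  have SE: "S \<subseteq> E" using bS by (simp add: bond_closed_def)
  have lt: "1 \<le> i \<and> i < j \<and> j \<le> n" if "(i, j) \<in> E" for i j
    using G that by (auto simp: graph_on_def)
  define R where "R = S \<union> edges_upto E k"
  have RE: "R \<subseteq> E" using SE by (auto simp: R_def edges_upto_def)
  define T where "T = E \<inter> linked R"
  have RT: "R \<subseteq> T" using RE linked_edge by (auto simp: T_def)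
  have lnk: "linked T = linked R"
    using linked_mono[OF RT] linked_subset_linked[of T R] by (auto simp: T_def)
  have "(a, b) \<in> linked R"
    if e: "(a, c) \<in> R" "(b, d) \<in> R" "a < b" "b < c" "c < d" for a b c d
  \<comment> \<open>If \<open>c\<close> is at most \<open>k\<close>, crossing closedness links
    \<open>a\<close> and \<open>b\<close> inside \<open>E\<^sub>k\<close>. Otherwise both right ends
    exceed \<open>k\<close>, so both edges come from \<open>S\<close>, which is noncrossing.\<close>
  proof (cases "c \<le> k")
    case True
    then have "(a, b) \<in> linked (edges_upto E k)"
      using crossing_linked_upto[OF G pl cc _ _ e(3-5)] e RE by blast
    then show ?thesis using linked_mono[of "edges_upto E k" R] by (auto simp: R_def)
  next
    case False
    then have "(a, c) \<in> S" "(b, d) \<in> S" using e by (auto simp: R_def edges_upto_def)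
    then have "(a, b) \<in> linked S" using nS e unfolding noncrossing_edges_def by blast
    then show ?thesis using linked_mono[of S R] by (auto simp: R_def)
  qed
  then have "noncrossing_edges R" unfolding noncrossing_edges_def by blast
  moreover have "noncrossing_edges R \<longleftrightarrow> noncrossing_edges T"
    by (rule noncrossing_edges_cong[of _ _ n]) (use lnk lt RE in \<open>auto simp: T_def\<close>)
  moreover have "bond_closed E T" unfolding bond_closed_def lnk by (auto simp: T_def)
  ultimately have "T \<in> NC n E" by (simp add: NC_iff[OF G])
  moreover have "j \<in> snd ` S \<union> snd ` edges_upto E k" if ij: "(i, j) \<in> T" for i j
  proof (cases "j \<le> k")
    case True
    then have "(i, j) \<in> edges_upto E k" using ij by (auto simp: T_def edges_upto_def)
    then show ?thesis by force
  next
    case False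
    have ijR: "(j, i) \<in> linked R" "i < j" using ij lt linked_sym by (auto simp: T_def)
    \<comment> \<open>Were \<open>j\<close> minimal in its \<open>S\<close>-block, all vertices of
      that block would exceed \<open>k\<close>, so no edge of \<open>E\<^sub>k\<close> would touch
      it. Then \<open>R\<close> could not connect \<open>j\<close> to anything beyond the block, in
      particular not to \<open>i\<close>.\<close>
    have "\<exists>h. (j, h) \<in> linked S \<and> h < j"
    proof (rule ccontr)
      assume *: "\<nexists>h. (j, h) \<in> linked S \<and> h < j"
      from ijR(1) have "(j, i) \<in> linked S"
      proof (induction rule: linked_induct)
        case (step y z)
        have "k < y" using * step(3) False by force
        then have "(y, z) \<in> S \<or> (z, y) \<in> S"
          using step(2) lt[of y z] by (auto simp: R_def edges_upto_def)
        then show ?case using linked_step[OF step(3)] by blast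
      qed simp
      then show False using * ijR(2) by blast
    qed
    then obtain h where "(h, j) \<in> linked S" "h < j" using linked_sym by blast
    then have "j \<in> snd ` S"
      using linked_lower_neighbour[OF _ bond_perfectly_labeled[OF pl bS], of n h j] lt SE by blast
    then show ?thesis by blast
  qed
  then have "snd ` T \<subseteq> snd ` S \<union> snd ` edges_upto E k" by force
  ultimately show ?thesis using that RT by (auto simp: R_def)
qed

section \<open>The lattice, its maximal chain, and supersolvability\<close>

theorem theorem5p11:
  fixes n :: nat and E :: "(nat \<times> nat) set"
  assumes "graph_on n E"
    and "perfectly_labeled E"
    and "crossing_closed n E"
  shows "supersolvable_lattice (NC n E) (\<subseteq>)"
proof -
  let ?P = "NC n E" and ?le = "(\<subseteq>) :: edges \<Rightarrow> edges \<Rightarrow> bool"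
  note A = assms
  have lt: "1 \<le> i \<and> i < j \<and> j \<le> n" if "(i, j) \<in> E" for i j
    using A(1) that by (auto simp: graph_on_def)
  have bond: "bond_closed E S" if "S \<in> ?P" for S using that NC_iff[OF A(1)] by auto
  have sub: "S \<subseteq> E" if "S \<in> ?P" for S using bond[OF that] by (simp add: bond_closed_def)
  have "E \<subseteq> {1..n} \<times> {1..n}" using lt by fastforce
  then have finE: "finite E" by (rule finite_subset) simp
  have fin: "finite ?P" by (rule finite_subset[of _ "Pow E"]) (use sub finE in auto)
  have upto_n: "edges_upto E n = E" using lt by (auto simp: edges_upto_def)
  have upto_0: "edges_upto E 0 = {}" using lt by (fastforce simp: edges_upto_def)
  have upP: "edges_upto E k \<in> ?P" for k by (rule upto_in_NC[OF A])
  have EP: "E \<in> ?P" using upP[of n] upto_n by simp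
  have IntP: "S \<inter> T \<in> ?P" if "S \<in> ?P" "T \<in> ?P" for S T
    using Int_in_NC[OF A(1,3)] that .
  have po: "poset_on ?P ?le" by (auto simp: poset_on_def)
  have glb: "is_glb ?P ?le S T (S \<inter> T)" if "S \<in> ?P" "T \<in> ?P" for S T
    using IntP[OF that] by (auto simp: is_glb_def)
  have lub: "\<exists>z. is_lub ?P ?le S T z" if "S \<in> ?P" "T \<in> ?P" for S T
  proof -
    \<comment> \<open>The join is the intersection of all upper bounds; there is at least one,
      namely \<open>E\<close>.\<close>
    let ?U = "{w \<in> ?P. S \<subseteq> w \<and> T \<subseteq> w}"
    have "finite F \<Longrightarrow> F \<noteq> {} \<Longrightarrow> F \<subseteq> ?P \<Longrightarrow> \<Inter>F \<in> ?P" for F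
      by (induction rule: finite_ne_induct) (auto intro: IntP)
    moreover have "E \<in> ?U" using EP sub that by auto
    ultimately have "\<Inter>?U \<in> ?P" using fin by (metis (no_types, lifting) empty_iff finite_subset
          mem_Collect_eq subsetI)
    then have "is_lub ?P ?le S T (\<Inter>?U)" by (auto simp: is_lub_def)
    then show ?thesis by blast
  qed
  have L: "finite_lattice ?P ?le"
    unfolding finite_lattice_def using fin EP po lub glb by blast
  have meet: "lmeet ?P ?le S T = S \<inter> T" if "S \<in> ?P" "T \<in> ?P" for S T
    using glb[OF that] lmeet_is_glb[OF L that] unfolding is_glb_def by (meson subset_antisym)
  have join: "S \<subseteq> ljoin ?P ?le S T" "T \<subseteq> ljoin ?P ?le S T" "ljoin ?P ?le S T \<in> ?P"
    "\<And>U. U \<in> ?P \<Longrightarrow> S \<subseteq> U \<Longrightarrow> T \<subseteq> U \<Longrightarrow> ljoin ?P ?le S T \<subseteq> U"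
    if "S \<in> ?P" "T \<in> ?P" for S T
    using ljoin_is_lub[OF L that] unfolding is_lub_def by blast+
  have strict: "S = T" if "S \<in> ?P" "T \<in> ?P" "S \<subseteq> T" "snd ` S = snd ` T" for S T
    by (rule bond_eq_if_snd_image_eq[OF _ A(2)]) (use that bond lt in auto)
  define M where "M = range (edges_upto E)"
  have M: "is_chain ?P ?le M"
  proof -
    have "edges_upto E k \<subseteq> edges_upto E l \<or> edges_upto E l \<subseteq> edges_upto E k" for k l
      by (cases k l rule: le_cases) (auto simp: edges_upto_def)
    then show ?thesis using upP by (auto simp: is_chain_def M_def)
  qed
  \<comment> \<open>Maximality of \<open>M\<close> amounts to this: a noncrossing bond comparable
    with every \<open>E\<^sub>k\<close> is itself one of them.\<close>
  have inM: "S \<in> M" if S: "S \<in> ?P" and cmp: "\<And>k. edges_upto E k \<subseteq> S \<or> S \<subseteq> edges_upto E k" for S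
  proof (cases "E \<subseteq> S")
    case True
    then have "S = edges_upto E n" using sub S upto_n by auto
    then show ?thesis by (simp add: M_def)
  next
    case False
    \<comment> \<open>\<open>k\<close> is the last index before containment in \<open>S\<close>
      first fails; it exists because \<open>E\<^sub>0\<close> is empty and \<open>E\<^sub>n\<close>
      is \<open>E\<close>.\<close>
    then have "\<exists>k<n. (\<forall>i\<le>k. \<not> \<not> edges_upto E i \<subseteq> S) \<and> \<not> edges_upto E (Suc k) \<subseteq> S"
      by (intro ex_least_nat_less) (auto simp: upto_n upto_0)
    then obtain k where k: "edges_upto E k \<subseteq> S" "\<not> edges_upto E (Suc k) \<subseteq> S"
      by blast
    then have S': "S \<subseteq> edges_upto E (Suc k)" using cmp by blast
    \<comment> \<open>Passing to the next \<open>E\<^sub>k\<close> adds at most one right end, so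
      the right ends of \<open>S\<close> agree with those of a neighbour in the chain, and
      \<open>strict\<close> gives equality.\<close>
    have "snd ` edges_upto E (Suc k) \<subseteq> insert (Suc k) (snd ` edges_upto E k)"
      by (force simp: edges_upto_def)
    then have "snd ` S = snd ` edges_upto E k \<or> snd ` S = snd ` edges_upto E (Suc k)"
      by (rule between_insert[OF image_mono[OF k(1)] image_mono[OF S']])
    then have "S = edges_upto E k \<or> S = edges_upto E (Suc k)"
      using strict[OF upP S k(1)] strict[OF S upP S'] by metis
    then show ?thesis by (auto simp: M_def)
  qed
  have maxM: "maximal_chain ?P ?le M"
    unfolding maximal_chain_def
  proof (intro conjI M allI impI)
    fix D assume D: "is_chain ?P ?le D \<and> M \<subseteq> D"
    have "S \<in> M" if "S \<in> D" for S
    proof (rule inM)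
      show "S \<in> ?P" using D that by (auto simp: is_chain_def)
      have "edges_upto E k \<in> D" for k using D by (auto simp: M_def)
      then show "edges_upto E k \<subseteq> S \<or> S \<subseteq> edges_upto E k" for k
        using D that by (simp add: is_chain_def)
    qed
    then show "D = M" using D by blast
  qed
  have fmeet: "snd ` lmeet ?P ?le m S = snd ` m \<inter> snd ` S" if "m \<in> M" "S \<in> ?P" for m S
  proof -
    obtain k where k: "m = edges_upto E k" using \<open>m \<in> M\<close> by (auto simp: M_def)
    \<comment> \<open>The image commutes with this intersection because \<open>E\<^sub>k\<close> is
      cut out by a condition on right ends: an edge of \<open>S\<close> whose right end occurs in
      \<open>E\<^sub>k\<close> is itself in \<open>E\<^sub>k\<close>.\<close>
    have "snd ` (edges_upto E k \<inter> S) = snd ` edges_upto E k \<inter> snd ` S"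
      using sub[OF that(2)] by (force simp: edges_upto_def)
    then show ?thesis using k meet upP that by simp
  qed
  have fjoin: "snd ` ljoin ?P ?le m S = snd ` m \<union> snd ` S" if "m \<in> M" "S \<in> ?P" for m S
  proof -
    obtain k where k: "m = edges_upto E k" using \<open>m \<in> M\<close> by (auto simp: M_def)
    obtain T where T: "T \<in> ?P" "S \<subseteq> T" "edges_upto E k \<subseteq> T"
      "snd ` T \<subseteq> snd ` S \<union> snd ` edges_upto E k"
      using upper_bound_with_upto[OF A \<open>S \<in> ?P\<close>] by blast
    have mP: "m \<in> ?P" using k upP by simp
    note J = join[OF mP that(2)]
    \<comment> \<open>The join lies below the upper bound \<open>T\<close>, which has no right ends
      beyond those of \<open>S\<close> and \<open>E\<^sub>k\<close>.\<close>
    have "snd ` ljoin ?P ?le m S \<subseteq> snd ` T" using J(4) T k by (intro image_mono) auto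
    then show ?thesis using T(4) J(1,2) k by blast
  qed
  have "distributive_sub ?P ?le (gen_sublattice ?P ?le (M \<union> C))" if "is_chain ?P ?le C" for C
  proof (rule distributive_gen_sublattice[OF L _ strict M that, where b = "{}" and t = E])
    show "{} \<in> M" "E \<in> M" using upto_0 upto_n unfolding M_def by (metis rangeI)+
    show "snd ` S \<subseteq> snd ` T" if "S \<subseteq> T" for S T :: edges using that by (rule image_mono)
    show "{} \<subseteq> S" for S :: edges by simp
  qed (assumption | fact sub fmeet fjoin)+
  then show ?thesis unfolding supersolvable_lattice_def using L maxM by blast
qed

end
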